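(* For every integer $m\ge1$, within the space of two-person symmetric games of size $m\times m$, the set of games that have a unique symmetric Nash equilibrium and such that this Nash equilibrium is quasi-strict is open.
   Context: A two-person game of size $m\times m$ has strategy sets $S^1,S^2$ of cardinality $m$ and utility functions $U^1,U^2:S^1\times S^2\to\mathbb{R}$, extended bilinearly to mixed strategies. It is symmetric if $S^1=S^2$ (after identification) and $U^2(s,t)=U^1(t,s)$ for all $s,t$. The space of symmetric $m\times m$ games carries the topology induced from the payoff space (equivalently, it is identified with the space of $m\times m$ real matrices, the payoff matrix of player 1). A symmetric Nash equilibrium is a Nash equilibrium in mixed strategies $(\sigma^1,\sigma^2)$ with $\sigma^1=\sigma^2$. "Unique symmetric Nash equilibrium" does not exclude the existence of asymmetric Nash equilibria. A Nash equilibrium $\sigma$ is quasi-strict if for every player $i$, every pure best response of player $i$ to the strategy of the other player belongs to the support of $\sigma^i$. *)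

theory Defs
  imports "HOL-Analysis.Analysis"
begin

text \<open>The pure strategies of the two players are the elements of the finite types
  \<open>'a\<close> and \<open>'b\<close>. In a payoff matrix \<open>U\<close> of either player, \<open>U $ s $ t\<close> is the payoff when
  player 1 plays \<open>s\<close> and player 2 plays \<open>t\<close>. The product type carries the product
  (Euclidean) topology of the payoff space.\<close>

type_synonym ('a, 'b) game = "(real ^ 'b ^ 'a) \<times> (real ^ 'b ^ 'a)"

type_synonym ('a, 'b) profile = "(real ^ 'a) \<times> (real ^ 'b)"

definition mixed_strategies :: "(real ^ 'a::finite) set" where
  "mixed_strategies = {x. (\<forall>s. 0 \<le> x $ s) \<and> (\<Sum>s\<in>UNIV. x $ s) = 1}"

definition pure_strategy :: "'a::finite \<Rightarrow> real ^ 'a" where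
  "pure_strategy s = axis s 1"

definition support :: "real ^ 'a::finite \<Rightarrow> 'a set" where
  "support x = {s. 0 < x $ s}"

definition payoff :: "real ^ 'b ^ 'a \<Rightarrow> real ^ 'a::finite \<Rightarrow> real ^ 'b::finite \<Rightarrow> real" where
  "payoff U x y = (\<Sum>s\<in>UNIV. \<Sum>t\<in>UNIV. x $ s * y $ t * U $ s $ t)"

definition best_responses1 :: "('a::finite, 'b::finite) game \<Rightarrow> real ^ 'b \<Rightarrow> (real ^ 'a) set" where
  "best_responses1 G y =
     {x \<in> mixed_strategies. \<forall>x' \<in> mixed_strategies. payoff (fst G) x' y \<le> payoff (fst G) x y}"

definition best_responses2 :: "('a::finite, 'b::finite) game \<Rightarrow> real ^ 'a \<Rightarrow> (real ^ 'b) set" where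
  "best_responses2 G x =
     {y \<in> mixed_strategies. \<forall>y' \<in> mixed_strategies. payoff (snd G) x y' \<le> payoff (snd G) x y}"

definition nash_equilibrium :: "('a::finite, 'b::finite) game \<Rightarrow> ('a, 'b) profile \<Rightarrow> bool" where
  "nash_equilibrium G p \<longleftrightarrow>
     fst p \<in> best_responses1 G (snd p) \<and> snd p \<in> best_responses2 G (fst p)"

definition quasi_strict :: "('a::finite, 'b::finite) game \<Rightarrow> ('a, 'b) profile \<Rightarrow> bool" where
  "quasi_strict G p \<longleftrightarrow>
     (\<forall>s. pure_strategy s \<in> best_responses1 G (snd p) \<longrightarrow> s \<in> support (fst p)) \<and>
     (\<forall>t. pure_strategy t \<in> best_responses2 G (fst p) \<longrightarrow> t \<in> support (snd p))"

definition symmetric_games :: "('a::finite, 'a) game set" where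
  "symmetric_games = {G. \<forall>s t. snd G $ s $ t = fst G $ t $ s}"

definition symmetric_nash_equilibrium :: "('a::finite, 'a) game \<Rightarrow> ('a, 'a) profile \<Rightarrow> bool" where
  "symmetric_nash_equilibrium G p \<longleftrightarrow> nash_equilibrium G p \<and> fst p = snd p"

end

theory Submission
  imports Defs
begin

text \<open>A symmetric equilibrium of a symmetric game with payoff matrix \<open>A\<close> is a point \<open>x\<close> of the
  simplex with \<open>(A x)\<^sub>s \<le> x \<cdot> A x\<close> for all \<open>s\<close>. One always exists, by Brouwer's theorem. If \<open>A\<close> has
  a unique symmetric equilibrium, quasi-strict and with support \<open>C\<close>, then by compactness of the
  simplex every symmetric equilibrium of every matrix \<open>B\<close> near \<open>A\<close> has support \<open>C\<close> and is
  quasi-strict. Such a \<open>B\<close> cannot have two symmetric equilibria: if \<open>q\<close> is one at maximal distance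
  from another one \<open>p\<close>, then \<open>q + \<epsilon>(q - p)\<close> is again an equilibrium for small \<open>\<epsilon> > 0\<close>, and it is
  farther away from \<open>p\<close>.\<close>

section \<open>Symmetric equilibria of a payoff matrix\<close>

text \<open>Only pure deviations are tested: the payoff is linear in the deviating strategy, so
  mixed deviations gain nothing more. This leaves finitely many polynomial inequalities.\<close>

definition symmetric_equilibria :: "real ^ 'n ^ 'n \<Rightarrow> (real ^ 'n::finite) set" where
  "symmetric_equilibria A =
     {x \<in> mixed_strategies. \<forall>s. (A *v x) $ s \<le> x \<bullet> (A *v x)}"

lemma payoff_eq_inner: "payoff U x y = x \<bullet> (U *v y)"
  by (simp add: payoff_def inner_vec_def matrix_vector_mult_def sum_distrib_left mult_ac)

lemma pure_strategy_mixed: "pure_strategy s \<in> mixed_strategies"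
  by (simp add: pure_strategy_def mixed_strategies_def axis_def)

lemma inner_pure_strategy: "pure_strategy s \<bullet> v = v $ s"
  by (simp add: pure_strategy_def inner_axis')

lemma mixed_inner_le:
  assumes "x \<in> mixed_strategies" "\<And>s. v $ s \<le> c"
  shows "x \<bullet> v \<le> c"
proof -
  have "x \<bullet> v = (\<Sum>s\<in>UNIV. x $ s * v $ s)" by (simp add: inner_vec_def)
  also have "\<dots> \<le> (\<Sum>s\<in>UNIV. x $ s * c)"
    using assms by (intro sum_mono mult_left_mono) (auto simp: mixed_strategies_def)
  also have "\<dots> = c"
    using assms(1) by (simp add: mixed_strategies_def flip: sum_distrib_right)
  finally show ?thesis .
qed

lemma mixed_inner_eq_on_support:
  assumes "x \<in> mixed_strategies" "\<And>s. x $ s \<noteq> 0 \<Longrightarrow> v $ s = c"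
  shows "x \<bullet> v = c"
proof -
  have "x \<bullet> v = (\<Sum>s\<in>UNIV. x $ s * v $ s)" by (simp add: inner_vec_def)
  also have "\<dots> = (\<Sum>s\<in>UNIV. x $ s * c)"
    using assms(2) by (intro sum.cong) auto
  also have "\<dots> = c"
    using assms(1) by (simp add: mixed_strategies_def flip: sum_distrib_right)
  finally show ?thesis .
qed

text \<open>A weighted mean cannot lie strictly below every value that carries positive weight. This
  supplies the strategy without excess payoff at a fixed point of Nash's map.\<close>

lemma mixed_below_average_in_support:
  assumes "x \<in> mixed_strategies"
  obtains s where "0 < x $ s" "v $ s \<le> x \<bullet> v"
proof (rule ccontr)
  assume "\<not> thesis"
  then have above: "x \<bullet> v < v $ s" if "0 < x $ s" for s
    using that \<open>\<And>s. 0 < x $ s \<Longrightarrow> v $ s \<le> x \<bullet> v \<Longrightarrow> thesis\<close> by fastforce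
  have nonneg: "\<And>s. 0 \<le> x $ s" and total: "(\<Sum>s\<in>UNIV. x $ s) = 1"
    using assms by (auto simp: mixed_strategies_def)
  obtain s where s: "0 < x $ s"
    using total nonneg by (metis less_eq_real_def sum.neutral zero_neq_one)
  have "(\<Sum>s\<in>UNIV. x $ s * (x \<bullet> v)) < (\<Sum>s\<in>UNIV. x $ s * v $ s)"
  proof (rule sum_strict_mono_ex1)
    show "\<forall>t\<in>UNIV. x $ t * (x \<bullet> v) \<le> x $ t * v $ t"
      using above nonneg
      by (metis less_eq_real_def mult_left_mono mult_zero_left)
    show "\<exists>t\<in>UNIV. x $ t * (x \<bullet> v) < x $ t * v $ t"
      using above[OF s] s by (intro bexI[of _ s]) auto
  qed simp
  then show False
    using total by (simp add: inner_vec_def flip: sum_distrib_right)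
qed

text \<open>The losses \<open>?c - (A *v x) $ t\<close> are nonnegative and their mean under
  \<open>x\<close> is zero, so each one with nonzero weight vanishes.\<close>

lemma symmetric_equilibrium_complementarity:
  assumes "x \<in> symmetric_equilibria A" "x $ s \<noteq> 0"
  shows "(A *v x) $ s = x \<bullet> (A *v x)"
proof -
  let ?c = "x \<bullet> (A *v x)"
  have mixed: "x \<in> mixed_strategies" and le: "\<And>t. (A *v x) $ t \<le> ?c"
    using assms by (auto simp: symmetric_equilibria_def)
  have "(\<Sum>t\<in>UNIV. x $ t * (?c - (A *v x) $ t)) = 0"
    using mixed by (simp add: inner_vec_def mixed_strategies_def right_diff_distrib sum_subtractf
        flip: sum_distrib_right)
  moreover have "0 \<le> x $ t * (?c - (A *v x) $ t)" for t
    using mixed le[of t] by (simp add: mixed_strategies_def)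
  ultimately have "x $ s * (?c - (A *v x) $ s) = 0"
    by (simp add: sum_nonneg_eq_0_iff)
  with assms(2) show ?thesis by simp
qed

section \<open>Compactness and existence\<close>

lemma closed_mixed_strategies: "closed (mixed_strategies :: (real ^ 'n::finite) set)"
  unfolding mixed_strategies_def
  by (intro closed_Collect_conj closed_Collect_all closed_Collect_le closed_Collect_eq
      continuous_intros)

lemma compact_mixed_strategies: "compact (mixed_strategies :: (real ^ 'n::finite) set)"
proof -
  have "norm x \<le> 1" if "x \<in> mixed_strategies" for x :: "real ^ 'n"
    using that norm_le_l1_cart[of x] by (simp add: mixed_strategies_def)
  then have "bounded (mixed_strategies :: (real ^ 'n) set)"
    unfolding bounded_iff by blast
  with closed_mixed_strategies show ?thesis
    by (simp add: compact_eq_bounded_closed)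
qed

lemma convex_mixed_strategies: "convex (mixed_strategies :: (real ^ 'n::finite) set)"
  by (auto simp: convex_def mixed_strategies_def sum.distrib simp flip: sum_distrib_left)

lemma continuous_on_matrix_vector_mult [continuous_intros]:
  fixes f :: "'a::topological_space \<Rightarrow> real ^ 'n ^ 'm::finite" and g :: "'a \<Rightarrow> real ^ 'n::finite"
  assumes "continuous_on S f" "continuous_on S g"
  shows "continuous_on S (\<lambda>x. f x *v g x)"
  unfolding matrix_vector_mult_def by (intro continuous_intros assms)

text \<open>Strategy and matrix vary jointly here, so that the graph can later be projected along
  the compact simplex onto the space of matrices.\<close>

lemma closed_symmetric_equilibria_graph:
  "closed {(x, A). x \<in> symmetric_equilibria (A :: real ^ 'n ^ 'n::finite)}"
proof -
  have "closed {p :: (real ^ 'n) \<times> (real ^ 'n ^ 'n).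
      \<forall>s. (snd p *v fst p) $ s \<le> fst p \<bullet> (snd p *v fst p)}" (is "closed ?L")
    by (intro closed_Collect_all closed_Collect_le continuous_intros)
  moreover have "closed (mixed_strategies \<times> UNIV :: ((real ^ 'n) \<times> (real ^ 'n ^ 'n)) set)"
      (is "closed ?M")
    by (intro closed_Times closed_UNIV closed_mixed_strategies)
  moreover have "{(x, A). x \<in> symmetric_equilibria A} = ?L \<inter> ?M"
    by (auto simp: symmetric_equilibria_def)
  ultimately show ?thesis by (simp only: closed_Int)
qed

lemma compact_symmetric_equilibria: "compact (symmetric_equilibria A)"
proof -
  have "closed {x. \<forall>s. (A *v x) $ s \<le> x \<bullet> (A *v x)}"
    by (intro closed_Collect_all closed_Collect_le continuous_intros)
  then have "compact (mixed_strategies \<inter> {x. \<forall>s. (A *v x) $ s \<le> x \<bullet> (A *v x)})"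
    by (rule compact_Int_closed[OF compact_mixed_strategies])
  moreover have "mixed_strategies \<inter> {x. \<forall>s. (A *v x) $ s \<le> x \<bullet> (A *v x)}
      = symmetric_equilibria A"
    by (auto simp: symmetric_equilibria_def)
  ultimately show ?thesis by simp
qed

text \<open>A fixed point \<open>x\<close> of Nash's map satisfies \<open>x\<^sub>s \<Sum>\<^sub>t e\<^sub>t = e\<^sub>s\<close> for the excess payoffs \<open>e\<close>. The excess
  vanishes at some \<open>s\<close> in the support of \<open>x\<close>, hence it vanishes everywhere.\<close>

lemma symmetric_equilibria_nonempty: "symmetric_equilibria A \<noteq> {}"
proof -
  define e where "e x s = max 0 ((A *v x) $ s - x \<bullet> (A *v x))" for x s
  define f where "f x = (\<chi> s. (x $ s + e x s) / (1 + (\<Sum>t\<in>UNIV. e x t)))" for x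
  have e_nonneg: "0 \<le> e x s" for x s by (simp add: e_def)
  have denom: "0 < 1 + (\<Sum>t\<in>UNIV. e x t)" for x
    by (simp add: add_pos_nonneg e_nonneg sum_nonneg)
  have "continuous_on mixed_strategies f"
    unfolding f_def e_def
    using denom[unfolded e_def]
    by (intro continuous_intros) (metis less_irrefl)
  moreover have "f \<in> mixed_strategies \<rightarrow> mixed_strategies"
  proof
    fix x :: "real ^ 'a" assume x: "x \<in> mixed_strategies"
    then have "(\<Sum>s\<in>UNIV. f x $ s) = 1"
      using denom[of x]
      by (simp add: f_def mixed_strategies_def sum.distrib flip: sum_divide_distrib)
    with x show "f x \<in> mixed_strategies"
      using denom[of x] e_nonneg by (simp add: f_def mixed_strategies_def)
  qed
  ultimately obtain x where x: "x \<in> mixed_strategies" "f x = x"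
    using brouwer[OF compact_mixed_strategies convex_mixed_strategies] pure_strategy_mixed
    by (metis empty_iff)
  have fixed: "x $ s * (\<Sum>t\<in>UNIV. e x t) = e x s" for s
  proof -
    have "x $ s = (x $ s + e x s) / (1 + (\<Sum>t\<in>UNIV. e x t))"
      using x(2) by (simp add: f_def vec_eq_iff)
    then show ?thesis using denom[of x] by (simp add: field_simps)
  qed
  obtain s where "0 < x $ s" "(A *v x) $ s \<le> x \<bullet> (A *v x)"
    using mixed_below_average_in_support[OF x(1)] .
  then have "(\<Sum>t\<in>UNIV. e x t) = 0"
    using fixed[of s] by (simp add: e_def)
  then have "e x t = 0" for t
    using fixed[of t] by simp
  then have "(A *v x) $ t \<le> x \<bullet> (A *v x)" for t
    unfolding e_def by (metis diff_le_0_iff_le max.cobounded2)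
  with x(1) have "x \<in> symmetric_equilibria A"
    by (simp add: symmetric_equilibria_def)
  then show ?thesis by blast
qed

section \<open>Openness in the space of matrices\<close>

text \<open>With the support \<open>C\<close> common to all equilibria, equality of payoffs on
  \<open>C\<close> is preserved along the line through two of them, while the remaining conditions
  are strict and so persist slightly beyond an endpoint.\<close>

lemma symmetric_equilibrium_unique:
  assumes strict: "\<And>y. y \<in> symmetric_equilibria A \<Longrightarrow>
      (\<forall>s\<in>C. 0 < y $ s) \<and> (\<forall>s. s \<notin> C \<longrightarrow> (A *v y) $ s < y \<bullet> (A *v y))"
    and p: "p \<in> symmetric_equilibria A" and r: "r \<in> symmetric_equilibria A"
  shows "r = p"
proof (rule ccontr)
  assume "r \<noteq> p"
  obtain q where q: "q \<in> symmetric_equilibria A"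
    and far: "\<And>y. y \<in> symmetric_equilibria A \<Longrightarrow> dist p y \<le> dist p q"
    using distance_attains_sup[OF compact_symmetric_equilibria] p by blast
  have "q \<noteq> p" using far[OF r] \<open>r \<noteq> p\<close> by auto
  define d where "d = q - p"
  define c where "c y = y \<bullet> (A *v y)" for y
  \<comment> \<open>By complementarity, a strategy with nonzero weight earns exactly the equilibrium
    value, which \<open>strict\<close> forbids outside \<open>C\<close> and enforces on
    \<open>C\<close>.\<close>
  have off: "y $ s = 0" if "y \<in> symmetric_equilibria A" "s \<notin> C" for y s
    using that strict symmetric_equilibrium_complementarity by (metis less_irrefl)
  have on: "(A *v y) $ s = c y" if "y \<in> symmetric_equilibria A" "s \<in> C" for y s
    using that strict symmetric_equilibrium_complementarity unfolding c_def
    by (metis less_irrefl)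
  define z where "z \<epsilon> = q + \<epsilon> *\<^sub>R d" for \<epsilon> :: real
  \<comment> \<open>This extrapolates the equilibrium values affinely. Although the payoff of
    \<open>z \<epsilon>\<close> against itself is quadratic in \<epsilon>, it equals
    \<open>k \<epsilon>\<close> once \<open>z \<epsilon>\<close> is a mixed strategy, because all
    payoffs on \<open>C\<close> equal \<open>k \<epsilon>\<close>.\<close>
  define k where "k \<epsilon> = c q + \<epsilon> * (c q - c p)" for \<epsilon>
  have Az: "(A *v z \<epsilon>) $ s = (A *v q) $ s + \<epsilon> * ((A *v q) $ s - (A *v p) $ s)" for \<epsilon> s
    by (simp add: z_def d_def matrix_vector_right_distrib matrix_vector_mult_diff_distrib
        scaleR_matrix_vector_assoc matrix_vector_mult_scaleR)
  have pos: "\<forall>\<^sub>F \<epsilon> in at_right 0. 0 < z \<epsilon> $ s" if "s \<in> C" for s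
  proof (rule order_tendstoD)
    show "((\<lambda>\<epsilon>. z \<epsilon> $ s) \<longlongrightarrow> q $ s + 0 * d $ s) (at_right 0)"
      unfolding z_def vector_add_component vector_scaleR_component real_scaleR_def
      by (intro tendsto_intros)
    show "0 < q $ s + 0 * d $ s" using strict[OF q] that by simp
  qed
  have below: "\<forall>\<^sub>F \<epsilon> in at_right 0. 0 < k \<epsilon> - (A *v z \<epsilon>) $ s" if "s \<notin> C" for s
  proof (rule order_tendstoD)
    show "((\<lambda>\<epsilon>. k \<epsilon> - (A *v z \<epsilon>) $ s) \<longlongrightarrow> (c q + 0 * (c q - c p)) -
        ((A *v q) $ s + 0 * ((A *v q) $ s - (A *v p) $ s))) (at_right 0)"
      unfolding k_def Az by (intro tendsto_intros)
    show "0 < (c q + 0 * (c q - c p)) -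
        ((A *v q) $ s + 0 * ((A *v q) $ s - (A *v p) $ s))"
      using strict[OF q] that by (simp add: c_def)
  qed
  have "\<forall>\<^sub>F \<epsilon> in at_right 0.
      (s \<in> C \<longrightarrow> 0 < z \<epsilon> $ s) \<and> (s \<notin> C \<longrightarrow> 0 < k \<epsilon> - (A *v z \<epsilon>) $ s)" for s
    using pos[of s] below[of s] by (cases "s \<in> C") simp_all
  then have "\<forall>\<^sub>F \<epsilon> in at_right 0. 0 < \<epsilon> \<and>
      (\<forall>s. (s \<in> C \<longrightarrow> 0 < z \<epsilon> $ s) \<and> (s \<notin> C \<longrightarrow> 0 < k \<epsilon> - (A *v z \<epsilon>) $ s))"
    by (rule eventually_conj[OF eventually_at_right_less eventually_all_finite])
  from eventually_happens'[OF trivial_limit_at_right_real this]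
  obtain \<epsilon> where \<epsilon>: "0 < \<epsilon>" and z: "\<And>s. (s \<in> C \<longrightarrow> 0 < z \<epsilon> $ s) \<and>
      (s \<notin> C \<longrightarrow> 0 < k \<epsilon> - (A *v z \<epsilon>) $ s)" by blast
  have z_pos: "0 < z \<epsilon> $ s" if "s \<in> C" for s
    using z that by blast
  have z_below: "(A *v z \<epsilon>) $ s < k \<epsilon>" if "s \<notin> C" for s
    using z[of s] that by simp
  have z_off: "z \<epsilon> $ s = 0" if "s \<notin> C" for s
    using off[OF p that] off[OF q that] by (simp add: z_def d_def)
  have z_on: "(A *v z \<epsilon>) $ s = k \<epsilon>" if "s \<in> C" for s
    using on[OF p that] on[OF q that] by (simp add: Az k_def)
  have "(\<Sum>s\<in>UNIV. z \<epsilon> $ s) = 1"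
    using p q by (simp add: z_def d_def symmetric_equilibria_def mixed_strategies_def sum.distrib
        sum_subtractf flip: sum_distrib_left)
  moreover have "0 \<le> z \<epsilon> $ s" for s
    using z_pos z_off by (metis less_eq_real_def)
  ultimately have mixed: "z \<epsilon> \<in> mixed_strategies"
    by (simp add: mixed_strategies_def)
  have "z \<epsilon> \<bullet> (A *v z \<epsilon>) = k \<epsilon>"
    using mixed z_on z_off by (metis mixed_inner_eq_on_support)
  moreover have "(A *v z \<epsilon>) $ s \<le> k \<epsilon>" for s
    using z_on z_below by (metis less_eq_real_def)
  ultimately have "z \<epsilon> \<in> symmetric_equilibria A"
    using mixed by (simp add: symmetric_equilibria_def)
  then have "dist p (z \<epsilon>) \<le> dist p q" by (rule far)
  moreover have "z \<epsilon> - p = (1 + \<epsilon>) *\<^sub>R d"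
    by (simp add: z_def d_def algebra_simps)
  then have "dist p (z \<epsilon>) = (1 + \<epsilon>) * dist p q"
    using \<epsilon> by (simp add: dist_norm d_def norm_minus_commute[of p])
  ultimately show False
    using \<epsilon> \<open>q \<noteq> p\<close> by simp
qed

text \<open>At an equilibrium \<open>x \<bullet> (A *v x)\<close> is the maximal payoff against
  \<open>x\<close>, so the equality singles out the pure best responses.\<close>

definition quasi_strict_symmetric :: "real ^ 'n ^ 'n \<Rightarrow> real ^ 'n::finite \<Rightarrow> bool" where
  "quasi_strict_symmetric A x \<longleftrightarrow> (\<forall>s. (A *v x) $ s = x \<bullet> (A *v x) \<longrightarrow> 0 < x $ s)"

lemma open_unique_quasi_strict:
  "open {A :: real ^ 'n ^ 'n::finite. (\<exists>!x. x \<in> symmetric_equilibria A) \<and>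
     (\<forall>x\<in>symmetric_equilibria A. quasi_strict_symmetric A x)}" (is "open ?U")
proof (rule Topological_Spaces.openI)
  fix A :: "real ^ 'n ^ 'n" assume "A \<in> ?U"
  then obtain x where x: "x \<in> symmetric_equilibria A" "quasi_strict_symmetric A x"
    and unique: "\<And>y. y \<in> symmetric_equilibria A \<Longrightarrow> y = x" by blast
  define C where "C = support x"
  \<comment> \<open>Fixing \<open>C\<close> turns quasi-strictness with support \<open>C\<close>
    into finitely many strict inequalities, hence an open condition on pairs. \<open>W\<close>
    collects the matrices all of whose symmetric equilibria satisfy it.\<close>
  define Q where "Q = (\<Inter>s. {p :: (real ^ 'n) \<times> (real ^ 'n ^ 'n).
    (s \<in> C \<longrightarrow> 0 < fst p $ s) \<and>
    (s \<notin> C \<longrightarrow> (snd p *v fst p) $ s < fst p \<bullet> (snd p *v fst p))})"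
  define W where "W = - (snd ` ({(y, B). y \<in> symmetric_equilibria B} \<inter> - Q))"
  have "open Q"
    unfolding Q_def
    by (intro open_INT finite ballI open_Collect_conj open_Collect_imp closed_Collect_const
        open_Collect_less continuous_intros)
  then have "closed ({(y, B). y \<in> symmetric_equilibria B} \<inter> - Q)"
    by (intro closed_Int closed_symmetric_equilibria_graph) (simp add: closed_Compl)
  \<comment> \<open>Projection along a compact factor preserves closedness, so the matrices with an
    equilibrium violating \<open>Q\<close> form a closed set.\<close>
  then have "closed {B. \<exists>y. y \<in> mixed_strategies \<and>
      (y, B) \<in> {(y, B). y \<in> symmetric_equilibria B} \<inter> - Q}"
    by (rule closed_compact_projection[OF compact_mixed_strategies])
  also have "{B. \<exists>y. y \<in> mixed_strategies \<and>
      (y, B) \<in> {(y, B). y \<in> symmetric_equilibria B} \<inter> - Q} = - W"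
    by (force simp: W_def symmetric_equilibria_def)
  finally have "open W" by (simp add: closed_def)
  moreover have "A \<in> W"
  proof -
    \<comment> \<open>The equilibrium condition gives the weak inequality, and quasi-strictness
      excludes equality outside the support.\<close>
    have "(A *v x) $ s < x \<bullet> (A *v x)" if "\<not> 0 < x $ s" for s
      using that x unfolding quasi_strict_symmetric_def symmetric_equilibria_def
      by (metis (mono_tags, lifting) mem_Collect_eq less_eq_real_def)
    then have "(x, A) \<in> Q" by (simp add: Q_def C_def support_def)
    then show ?thesis using unique by (auto simp: W_def)
  qed
  moreover have "W \<subseteq> ?U"
  proof
    fix B assume "B \<in> W"
    then have strict: "(\<forall>s\<in>C. 0 < y $ s) \<and> (\<forall>s. s \<notin> C \<longrightarrow> (B *v y) $ s < y \<bullet> (B *v y))"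
      if "y \<in> symmetric_equilibria B" for y
      using that by (force simp: W_def Q_def)
    have "\<exists>!y. y \<in> symmetric_equilibria B"
      using symmetric_equilibria_nonempty[of B] symmetric_equilibrium_unique[of B C] strict
      by (metis ex_in_conv)
    moreover have "quasi_strict_symmetric B y" if "y \<in> symmetric_equilibria B" for y
      using strict[OF that] unfolding quasi_strict_symmetric_def by (metis less_irrefl)
    ultimately show "B \<in> ?U" by blast
  qed
  ultimately show "\<exists>T. open T \<and> A \<in> T \<and> T \<subseteq> ?U" by blast
qed

section \<open>Symmetric games\<close>

lemma best_responses1_iff:
  "x \<in> best_responses1 G y \<longleftrightarrow>
     x \<in> mixed_strategies \<and> (\<forall>s. (fst G *v y) $ s \<le> x \<bullet> (fst G *v y))"
  unfolding best_responses1_def payoff_eq_inner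
  using mixed_inner_le pure_strategy_mixed inner_pure_strategy
  by (smt (verit, best) mem_Collect_eq)

text \<open>The second matrix is the transpose of the first, so exchanging the order of summation
  turns player 2's problem into player 1's.\<close>

lemma best_responses2_symmetric:
  assumes "G \<in> symmetric_games"
  shows "best_responses2 G x = best_responses1 G x"
proof -
  have "payoff (snd G) x y = payoff (fst G) y x" for y
    using assms unfolding payoff_def symmetric_games_def
    by (subst sum.swap) (simp add: mult_ac)
  then show ?thesis by (simp add: best_responses1_def best_responses2_def)
qed

lemma symmetric_nash_equilibrium_iff:
  assumes "G \<in> symmetric_games"
  shows "symmetric_nash_equilibrium G p \<longleftrightarrow>
    fst p \<in> symmetric_equilibria (fst G) \<and> snd p = fst p"
  using best_responses2_symmetric[OF assms]
  by (auto simp: symmetric_nash_equilibrium_def nash_equilibrium_def best_responses1_iff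
      symmetric_equilibria_def)

lemma quasi_strict_iff:
  assumes "G \<in> symmetric_games" "x \<in> symmetric_equilibria (fst G)"
  shows "quasi_strict G (x, x) \<longleftrightarrow> quasi_strict_symmetric (fst G) x"
proof -
  let ?v = "fst G *v x"
  have x: "x \<in> mixed_strategies" "\<And>s. ?v $ s \<le> x \<bullet> ?v"
    using assms(2) by (auto simp: symmetric_equilibria_def)
  have "pure_strategy s \<in> best_responses1 G x \<longleftrightarrow> ?v $ s = x \<bullet> ?v" for s
    using mixed_inner_le[OF x(1), of ?v "?v $ s"] x(2)
    by (auto simp: best_responses1_iff pure_strategy_mixed inner_pure_strategy intro: antisym)
  then show ?thesis
    by (simp add: quasi_strict_def quasi_strict_symmetric_def support_def
        best_responses2_symmetric[OF assms(1)])
qed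

theorem proposition8:
  shows "openin (top_of_set symmetric_games)
     {G :: ('n::finite, 'n) game. G \<in> symmetric_games \<and>
        (\<exists>!p. symmetric_nash_equilibrium G p) \<and>
        (\<forall>p. symmetric_nash_equilibrium G p \<longrightarrow> quasi_strict G p)}"
    (is "openin _ ?S")
proof -
  define U where "U = {A :: real ^ 'n ^ 'n. (\<exists>!x. x \<in> symmetric_equilibria A) \<and>
     (\<forall>x\<in>symmetric_equilibria A. quasi_strict_symmetric A x)}"
  define S where "S = ?S"
  have "G \<in> S \<longleftrightarrow> fst G \<in> U" if G: "G \<in> symmetric_games" for G
  proof -
    have sne: "symmetric_nash_equilibrium G (x, y) \<longleftrightarrow>
        x \<in> symmetric_equilibria (fst G) \<and> y = x" for x y
      by (simp add: symmetric_nash_equilibrium_iff[OF G])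
    have "(\<exists>!p. symmetric_nash_equilibrium G p) \<longleftrightarrow> (\<exists>!x. x \<in> symmetric_equilibria (fst G))"
      unfolding Ex1_def split_paired_Ex split_paired_All sne by auto
    moreover have "(\<forall>p. symmetric_nash_equilibrium G p \<longrightarrow> quasi_strict G p) \<longleftrightarrow>
        (\<forall>x\<in>symmetric_equilibria (fst G). quasi_strict_symmetric (fst G) x)"
      unfolding split_paired_All sne using quasi_strict_iff[OF G] by auto
    ultimately show ?thesis
      unfolding S_def U_def mem_Collect_eq using G by argo
  qed
  moreover have "S \<subseteq> symmetric_games"
    unfolding S_def by (rule Collect_restrict)
  \<comment> \<open>On symmetric games the condition depends on player 1's matrix alone, so openness
    of \<open>U\<close> pulls back along the continuous projection \<open>fst\<close>.\<close>
  ultimately have "S = symmetric_games \<inter> fst -` U" by blast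
  moreover have "open (fst -` U :: ('n, 'n) game set)"
    unfolding U_def by (intro open_vimage_fst open_unique_quasi_strict)
  ultimately have "openin (top_of_set symmetric_games) S"
    by (simp only: openin_open_Int)
  then show ?thesis unfolding S_def .
qed

end
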